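(* Let $\mathcal{F}$ be a class of order types such that for every $\rho\in\mathcal{F}$, either $\rho\equiv\rho^2$ or one of $\rho,\rho^*$ is an infinite regular cardinal. Let $\mathcal{T}$ be the class of order types obtained by closing $\{0,1\}$ under $\rho$-shuffles (for $\rho\in\mathcal{F}$ with $\rho\equiv\rho^2$) and under regular unbounded $\rho$-sums (for $\rho\in\mathcal{F}$ such that one of $\rho,\rho^*$ is an infinite regular cardinal). Then for every $\varphi\in\mathcal{T}$, either $\varphi=1$ or $\varphi$ is equimorphic to an order type without finite $F$-classes.
   Context: Work in ZFC. Order types are isomorphism classes of linear orders; $0$ is the empty type, $1$ the one-point type; $\rho^*$ is the reverse of $\rho$. $\varphi\leqslant\psi$ means an order of type $\varphi$ embeds in one of type $\psi$; $\varphi\equiv\psi$ (equimorphic) means $\varphi\leqslant\psi$ and $\psi\leqslant\varphi$. The ordered sum $\sum_{x\in X}I_x$ over a linear order $X$ is $\{(i,x):x\in X,i\in I_x\}$ ordered by $(i,x)<(i',x')$ iff $x<x'$, or $x=x'$ and $i<i'$; $\rho^2$ is $\sum_{x\in\rho}\rho$. For an infinite regular cardinal $\kappa$, a regular unbounded $\kappa$-sum is a sum $\sum_{\alpha\in\kappa}\varphi_\alpha$ such that for each $\alpha$ the set $\{\beta\in\kappa:\varphi_\alpha\leqslant\varphi_\beta\}$ is unbounded to the right in $\kappa$; a regular unbounded $\kappa^*$-sum is a sum $\sum_{\alpha\in\kappa^*}\varphi_\alpha$ such that for each $\alpha$ the set $\{\beta\in\kappa^*:\varphi_\alpha\leqslant\varphi_\beta\}$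 is unbounded to the left in $\kappa^*$. For an order type $\rho$, a $\rho$-shuffle is a sum $\sum_{x\in\rho}\psi_x$ such that for each $x$ the set $\{y\in\rho:\psi_x\leqslant\psi_y\}$ is dense in $\rho$ (a subset $Y$ of a linear order $X$ is dense in $X$ if for all $x<y$ in $X$ there is $z\in Y$ with $x\le z\le y$). For a linear order $X$, the finite condensation $F$ relates $x,x'$ iff the closed interval between them is finite; its classes are the $F$-classes. *)

theory Defs
  imports Main
begin

text \<open>
  A linear order is a reflexive relation \<^term>\<open>r\<close> with \<^prop>\<open>Linear_order r\<close>, living on its field;
  the order types \<open>0\<close> and \<open>1\<close> are represented by the empty relation and by the relations \<open>{(a, a)}\<close>.
  Order types are never formed as quotients: a class of order types is a set of linear orders
  closed under isomorphism, and an equation between order types is an isomorphism. All orders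
  of interest live on one arbitrary type \<open>'u\<close>, which plays the role of the universe. The constant
  \<^const>\<open>iso\<close> is defined through initial segments, but by \<open>iso_iff2\<close> it is order isomorphism for
  arbitrary relations.
\<close>

definition order_type_class :: "'u rel set \<Rightarrow> bool" where
  "order_type_class \<F> \<longleftrightarrow>
     (\<forall>\<rho>\<in>\<F>. Linear_order \<rho>) \<and> (\<forall>\<rho>\<in>\<F>. \<forall>\<sigma>. (\<exists>f. iso \<sigma> \<rho> f) \<longrightarrow> \<sigma> \<in> \<F>)"

definition embeds :: "'a rel \<Rightarrow> 'b rel \<Rightarrow> bool" (infix "\<lesssim>\<^sub>o" 50) where
  "\<phi> \<lesssim>\<^sub>o \<psi> \<longleftrightarrow> (\<exists>f. f ` Field \<phi> \<subseteq> Field \<psi> \<and> inj_on f (Field \<phi>) \<and>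
     (\<forall>x\<in>Field \<phi>. \<forall>y\<in>Field \<phi>. (x, y) \<in> \<phi> \<longleftrightarrow> (f x, f y) \<in> \<psi>))"

definition equimorphic :: "'a rel \<Rightarrow> 'b rel \<Rightarrow> bool" (infix "\<equiv>\<^sub>o" 50) where
  "\<phi> \<equiv>\<^sub>o \<psi> \<longleftrightarrow> \<phi> \<lesssim>\<^sub>o \<psi> \<and> \<psi> \<lesssim>\<^sub>o \<phi>"

definition ordered_sum :: "'b rel \<Rightarrow> ('b \<Rightarrow> 'a rel) \<Rightarrow> ('a \<times> 'b) rel" where
  "ordered_sum X I =
     {((i, x), (i', x')) | i x i' x'.
        x \<in> Field X \<and> x' \<in> Field X \<and> i \<in> Field (I x) \<and> i' \<in> Field (I x') \<and>
        (x \<noteq> x' \<and> (x, x') \<in> X \<or> x = x' \<and> (i, i') \<in> I x)}"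

definition ordered_square :: "'a rel \<Rightarrow> ('a \<times> 'a) rel" where
  "ordered_square \<rho> = ordered_sum \<rho> (\<lambda>_. \<rho>)"

text \<open>
  \<^prop>\<open>Card_order \<kappa>\<close> says that \<open>\<kappa>\<close> is a well-order of the type of an initial ordinal, so the following
  says that the order type of \<open>\<kappa>\<close> is an infinite regular cardinal.
\<close>

definition infinite_regular_cardinal :: "'a rel \<Rightarrow> bool" where
  "infinite_regular_cardinal \<kappa> \<longleftrightarrow> infinite (Field \<kappa>) \<and> Card_order \<kappa> \<and> regularCard \<kappa>"

definition dense_subset :: "'a set \<Rightarrow> 'a rel \<Rightarrow> bool" where
  "dense_subset Y X \<longleftrightarrow> Y \<subseteq> Field X \<and>
     (\<forall>x y. (x, y) \<in> X \<and> x \<noteq> y \<longrightarrow> (\<exists>z\<in>Y. (x, z) \<in> X \<and> (z, y) \<in> X))"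

text \<open>
  The next three predicates say that the formal sum \<open>\<Sum>\<^sub>x\<^sub>\<in>\<^sub>\<rho> \<psi>\<^sub>x\<close> is a \<open>\<rho>\<close>-shuffle, a regular
  unbounded \<open>\<kappa>\<close>-sum (where \<open>\<rho> = \<kappa>\<close>), or a regular unbounded \<open>\<kappa>\<^sup>*\<close>-sum (where \<open>\<rho> = \<kappa>\<^sup>*\<close>),
  for \<open>\<kappa>\<close> an infinite regular cardinal. A subset is unbounded to the right iff it is
  \<^const>\<open>cofinal\<close>, and unbounded to the left iff it is \<^const>\<open>cofinal\<close> in the reverse order.
\<close>

definition shuffle_sum :: "'b rel \<Rightarrow> ('b \<Rightarrow> 'a rel) \<Rightarrow> bool" where
  "shuffle_sum \<rho> \<psi> \<longleftrightarrow>
     (\<forall>x\<in>Field \<rho>. dense_subset {y\<in>Field \<rho>. \<psi> x \<lesssim>\<^sub>o \<psi> y} \<rho>)"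

definition regular_unbounded_sum :: "'b rel \<Rightarrow> ('b \<Rightarrow> 'a rel) \<Rightarrow> bool" where
  "regular_unbounded_sum \<rho> \<psi> \<longleftrightarrow> infinite_regular_cardinal \<rho> \<and>
     (\<forall>\<alpha>\<in>Field \<rho>. cofinal {\<beta>\<in>Field \<rho>. \<psi> \<alpha> \<lesssim>\<^sub>o \<psi> \<beta>} \<rho>)"

definition regular_unbounded_reverse_sum :: "'b rel \<Rightarrow> ('b \<Rightarrow> 'a rel) \<Rightarrow> bool" where
  "regular_unbounded_reverse_sum \<rho> \<psi> \<longleftrightarrow> infinite_regular_cardinal (\<rho>\<inverse>) \<and>
     (\<forall>\<alpha>\<in>Field \<rho>. cofinal {\<beta>\<in>Field \<rho>. \<psi> \<alpha> \<lesssim>\<^sub>o \<psi> \<beta>} (\<rho>\<inverse>))"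

text \<open>
  \<open>sum_closure \<F>\<close> is the class \<open>\<T>\<close>. A sum lives on \<open>'u \<times> 'u\<close>, so its isomorphic copies on \<open>'u\<close>
  are added; for infinite \<open>'u\<close> such copies always exist.
\<close>

inductive_set sum_closure :: "'u rel set \<Rightarrow> 'u rel set" for \<F> :: "'u rel set" where
  zero: "{} \<in> sum_closure \<F>"
| one: "{(a, a)} \<in> sum_closure \<F>"
| shuffle:
    "\<lbrakk>\<rho> \<in> \<F>; \<rho> \<equiv>\<^sub>o ordered_square \<rho>; \<forall>x\<in>Field \<rho>. \<psi> x \<in> sum_closure \<F>;
      shuffle_sum \<rho> \<psi>; iso \<phi> (ordered_sum \<rho> \<psi>) f\<rbrakk> \<Longrightarrow> \<phi> \<in> sum_closure \<F>"
| unbounded_sum: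
    "\<lbrakk>\<rho> \<in> \<F>; \<forall>x\<in>Field \<rho>. \<psi> x \<in> sum_closure \<F>;
      regular_unbounded_sum \<rho> \<psi>; iso \<phi> (ordered_sum \<rho> \<psi>) f\<rbrakk> \<Longrightarrow> \<phi> \<in> sum_closure \<F>"
| unbounded_reverse_sum:
    "\<lbrakk>\<rho> \<in> \<F>; \<forall>x\<in>Field \<rho>. \<psi> x \<in> sum_closure \<F>;
      regular_unbounded_reverse_sum \<rho> \<psi>; iso \<phi> (ordered_sum \<rho> \<psi>) f\<rbrakk> \<Longrightarrow> \<phi> \<in> sum_closure \<F>"

text \<open>For \<open>x\<close> below \<open>x'\<close> the second of the two intervals adds nothing, and vice versa.\<close>

definition finite_condensation :: "'a rel \<Rightarrow> 'a rel" where
  "finite_condensation X =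
     {(x, x'). x \<in> Field X \<and> x' \<in> Field X \<and>
        finite ({z. (x, z) \<in> X \<and> (z, x') \<in> X} \<union> {z. (x', z) \<in> X \<and> (z, x) \<in> X})}"

definition no_finite_F_classes :: "'a rel \<Rightarrow> bool" where
  "no_finite_F_classes X \<longleftrightarrow> (\<forall>C \<in> Field X // finite_condensation X. infinite C)"

end

theory Submission
  imports Defs
begin

text \<open>
  Call an order thick if it is equimorphic to one without finite \<open>F\<close>-classes. By induction, every
  summand of a sum over \<open>\<rho>\<close> is \<open>1\<close> or thick. In all three kinds of sums, summands may be
  redistributed: for any map \<open>c\<close> on \<open>\<rho>\<close> there is a strictly increasing \<open>e\<close> on \<open>\<rho>\<close> such that
  \<open>\<psi>\<^bsub>c x\<^esub> \<le> \<psi>\<^bsub>e x\<^esub>\<close> for all \<open>x\<close>. For cardinals this is a transfinite recursion using regularity; for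
  shuffles it holds because \<open>\<rho>\<^sup>2 \<le> \<rho>\<close> yields pairwise disjoint nondegenerate intervals of \<open>\<rho>\<close>, in the
  order of \<open>\<rho>\<close>. If some nonempty \<open>\<psi>\<^sub>k\<close> is thick, then every summand \<open>1\<close> can therefore be replaced
  by \<open>\<psi>\<^sub>k\<close>. Otherwise all summands are \<open>0\<close> or \<open>1\<close>, and a nonempty sum is equimorphic to \<open>\<rho>\<close>. The
  order \<open>\<rho>\<close> is thick: a cardinal has no last element, and if \<open>\<rho>\<^sup>2 \<equiv> \<rho>\<close> has two points
  then \<open>\<omega> \<le> \<rho>\<close>, so that \<open>\<rho>\<close> is equimorphic to the sum of \<open>\<rho>\<close> copies of \<open>\<omega>\<close>.
\<close>

unbundle cardinal_syntax

subsection \<open>Embeddings\<close>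

definition order_embedding :: "('a \<Rightarrow> 'b) \<Rightarrow> 'a rel \<Rightarrow> 'b rel \<Rightarrow> bool" where
  "order_embedding f r s \<longleftrightarrow> f ` Field r \<subseteq> Field s \<and> inj_on f (Field r) \<and>
     (\<forall>x\<in>Field r. \<forall>y\<in>Field r. (x, y) \<in> r \<longleftrightarrow> (f x, f y) \<in> s)"

lemma embeds_iff: "r \<lesssim>\<^sub>o s \<longleftrightarrow> (\<exists>f. order_embedding f r s)"
  by (simp add: embeds_def order_embedding_def)

lemma order_embeddingD:
  assumes "order_embedding f r s" "x \<in> Field r"
  shows "f x \<in> Field s"
    and "y \<in> Field r \<Longrightarrow> (f x, f y) \<in> s \<longleftrightarrow> (x, y) \<in> r"
    and "y \<in> Field r \<Longrightarrow> f x = f y \<longleftrightarrow> x = y"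
  using assms by (auto simp: order_embedding_def inj_on_def)

lemma embeds_refl: "r \<lesssim>\<^sub>o r"
  unfolding embeds_def by (rule exI[of _ id]) auto

lemma embeds_trans:
  assumes "r \<lesssim>\<^sub>o s" "s \<lesssim>\<^sub>o t"
  shows "r \<lesssim>\<^sub>o t"
proof -
  obtain f g where f: "order_embedding f r s" and g: "order_embedding g s t"
    using assms by (auto simp: embeds_iff)
  have "order_embedding (g \<circ> f) r t"
    unfolding order_embedding_def inj_on_def
    using order_embeddingD[OF f] order_embeddingD[OF g] by auto
  then show ?thesis by (auto simp: embeds_iff)
qed

lemma equimorphic_refl: "r \<equiv>\<^sub>o r"
  by (simp add: equimorphic_def embeds_refl)

lemma equimorphic_trans: "r \<equiv>\<^sub>o s \<Longrightarrow> s \<equiv>\<^sub>o t \<Longrightarrow> r \<equiv>\<^sub>o t"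
  by (auto simp: equimorphic_def intro: embeds_trans)

lemma iso_order_embedding: "iso r s f \<Longrightarrow> order_embedding f r s"
  by (auto simp: iso_iff2 order_embedding_def bij_betw_def)

lemma iso_imp_equimorphic:
  assumes "iso r s f"
  shows "r \<equiv>\<^sub>o s"
proof -
  have b: "bij_betw f (Field r) (Field s)"
    and m: "\<And>x y. x \<in> Field r \<Longrightarrow> y \<in> Field r \<Longrightarrow> (x, y) \<in> r \<longleftrightarrow> (f x, f y) \<in> s"
    using assms by (auto simp: iso_iff2)
  let ?g = "inv_into (Field r) f"
  have g: "?g y \<in> Field r" "f (?g y) = y" if "y \<in> Field s" for y
    using that b by (auto simp: bij_betw_def inv_into_into f_inv_into_f)
  have "order_embedding ?g s r"
    unfolding order_embedding_def inj_on_def using g m by (metis image_subsetI)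
  then show ?thesis
    using iso_order_embedding[OF assms] by (auto simp: equimorphic_def embeds_iff)
qed

lemma dir_image_iso':
  assumes "inj_on f (Field r)"
  shows "iso r (dir_image r f) f"
proof -
  have "(f x, f y) \<in> dir_image r f \<longleftrightarrow> (x, y) \<in> r" if "x \<in> Field r" "y \<in> Field r" for x y
    using inj_onD[OF assms] that unfolding dir_image_def by (blast intro: FieldI1 FieldI2)
  then show ?thesis using assms by (simp add: iso_iff2 bij_betw_def dir_image_Field)
qed

text \<open>Totality of \<open>r\<close> makes strict monotonicity enough: if \<open>(x, y)\<close>
  fails in \<open>r\<close>, then \<open>y\<close> lies strictly below \<open>x\<close>, so
  \<open>f y\<close> lies strictly below \<open>f x\<close> and antisymmetry of \<open>s\<close>
  excludes \<open>(f x, f y)\<close>.\<close>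

lemma strict_mono_order_embedding:
  assumes "Linear_order r" "antisym s" "Refl s"
    and "\<And>x. x \<in> Field r \<Longrightarrow> f x \<in> Field s"
    and mono: "\<And>x y. (x, y) \<in> r \<Longrightarrow> x \<noteq> y \<Longrightarrow> (f x, f y) \<in> s \<and> f x \<noteq> f y"
  shows "order_embedding f r s"
proof -
  have tot: "x = y \<or> (x, y) \<in> r \<or> (y, x) \<in> r" if "x \<in> Field r" "y \<in> Field r" for x y
    using that assms(1) by (auto simp: order_on_defs total_on_def)
  have refl: "(x, x) \<in> r" if "x \<in> Field r" for x
    using that assms(1) by (auto simp: order_on_defs refl_on_def)
  show ?thesis
    unfolding order_embedding_def inj_on_def
    using assms(2-4) mono tot refl by (auto simp: antisym_def refl_on_def; metis)
qed

lemma singleton_embeds: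
  assumes "Refl s" "Field s \<noteq> {}"
  shows "{(a, a)} \<lesssim>\<^sub>o s"
proof -
  obtain b where "(b, b) \<in> s" "b \<in> Field s" using assms by (auto simp: refl_on_def)
  then show ?thesis unfolding embeds_def by (intro exI[of _ "\<lambda>_. b"]) (auto simp: Field_def)
qed

lemma embeds_empty_Field: "r \<lesssim>\<^sub>o s \<Longrightarrow> Field s = {} \<Longrightarrow> Field r = {}"
  by (auto simp: embeds_def)

lemma empty_equimorphic: "Field r = {} \<Longrightarrow> Field s = {} \<Longrightarrow> r \<equiv>\<^sub>o s"
  by (auto simp: equimorphic_def embeds_def)

subsection \<open>Ordered sums\<close>

lemma in_ordered_sum:
  "((i, x), (j, y)) \<in> ordered_sum X I \<longleftrightarrow>
     x \<in> Field X \<and> y \<in> Field X \<and> i \<in> Field (I x) \<and> j \<in> Field (I y) \<and>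
     (x \<noteq> y \<and> (x, y) \<in> X \<or> x = y \<and> (i, j) \<in> I x)"
  by (auto simp: ordered_sum_def)

lemma Field_ordered_sum:
  "Field (ordered_sum X I) = {(i, x). x \<in> Field X \<and> i \<in> Field (I x)}" (is "?L = ?R")
proof
  show "?L \<subseteq> ?R" by (auto simp: Field_def ordered_sum_def)
  show "?R \<subseteq> ?L"
  proof clarify
    fix i x assume x: "x \<in> Field X" "i \<in> Field (I x)"
    then obtain j where "(i, j) \<in> I x \<or> (j, i) \<in> I x" by (auto simp: Field_def)
    then have "((i, x), (j, x)) \<in> ordered_sum X I \<or> ((j, x), (i, x)) \<in> ordered_sum X I"
      using x by (auto simp: in_ordered_sum intro: FieldI1 FieldI2)
    then show "(i, x) \<in> ?L" by (auto intro: FieldI1 FieldI2)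
  qed
qed

lemma Linear_order_ordered_sum:
  assumes X: "Linear_order X" and I: "\<And>x. x \<in> Field X \<Longrightarrow> Linear_order (I x)"
  shows "Linear_order (ordered_sum X I)"
proof -
  have X': "trans X" "antisym X" "Total X" using X by (auto simp: order_on_defs)
  have I': "Refl (I x)" "trans (I x)" "antisym (I x)" "Total (I x)" if "x \<in> Field X" for x
    using I[OF that] by (auto simp: order_on_defs)
  have "trans (ordered_sum X I)"
  proof (rule transI, clarify)
    fix i x j y k z
    assume a: "((i, x), (j, y)) \<in> ordered_sum X I" "((j, y), (k, z)) \<in> ordered_sum X I"
    then have "y \<in> Field X" by (simp add: in_ordered_sum)
    with a show "((i, x), (k, z)) \<in> ordered_sum X I"
      using X'(1,2) I'(2)[of y] unfolding in_ordered_sum trans_def antisym_def by metis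
  qed
  moreover have "antisym (ordered_sum X I)"
  proof (rule antisymI, clarify)
    fix i x j y
    assume a: "((i, x), (j, y)) \<in> ordered_sum X I" "((j, y), (i, x)) \<in> ordered_sum X I"
    then have "y \<in> Field X" by (simp add: in_ordered_sum)
    with a show "i = j \<and> x = y"
      using X'(2) I'(3)[of y] unfolding in_ordered_sum antisym_def by metis
  qed
  moreover have "Refl (ordered_sum X I)"
    using I'(1) by (auto simp: refl_on_def Field_ordered_sum in_ordered_sum)
  moreover have "Total (ordered_sum X I)"
    unfolding total_on_def
  proof (intro ballI impI)
    fix p q
    assume pq: "p \<in> Field (ordered_sum X I)" "q \<in> Field (ordered_sum X I)" "p \<noteq> q"
    obtain i x j y where eq: "p = (i, x)" "q = (j, y)" by fastforce
    show "(p, q) \<in> ordered_sum X I \<or> (q, p) \<in> ordered_sum X I"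
      using X'(3) I'(4)[of x] pq unfolding eq Field_ordered_sum in_ordered_sum total_on_def
      by (cases "x = y") auto
  qed
  ultimately show ?thesis
    by (auto simp: order_on_defs refl_on_def Field_def)
qed

lemma ordered_sum_embeds:
  assumes e: "order_embedding e \<rho> \<sigma>" and em: "\<And>x. x \<in> Field \<rho> \<Longrightarrow> \<psi> x \<lesssim>\<^sub>o \<chi> (e x)"
  shows "ordered_sum \<rho> \<psi> \<lesssim>\<^sub>o ordered_sum \<sigma> \<chi>"
proof -
  obtain h where h: "\<And>x. x \<in> Field \<rho> \<Longrightarrow> order_embedding (h x) (\<psi> x) (\<chi> (e x))"
    using em unfolding embeds_iff by metis
  have "order_embedding (\<lambda>(i, x). (h x i, e x)) (ordered_sum \<rho> \<psi>) (ordered_sum \<sigma> \<chi>)"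
    unfolding order_embedding_def inj_on_def
    by (auto simp: Field_ordered_sum in_ordered_sum order_embeddingD[OF e] order_embeddingD[OF h])
  then show ?thesis by (auto simp: embeds_iff)
qed

text \<open>When every summand is \<open>0\<close> or \<open>1\<close>, the projection to the index
  is injective.\<close>

lemma ordered_sum_embeds_index:
  assumes X: "Linear_order X" and "\<And>x i j. x \<in> Field X \<Longrightarrow> i \<in> Field (I x) \<Longrightarrow> j \<in> Field (I x) \<Longrightarrow> i = j"
  shows "ordered_sum X I \<lesssim>\<^sub>o X"
proof -
  have "(i, j) \<in> I x" if "x \<in> Field X" "i \<in> Field (I x)" "j \<in> Field (I x)" for x i j
    using assms(2)[OF that(1)] that by (metis Field_def Un_iff DomainE RangeE FieldI1 FieldI2)
  moreover have "Refl X" using X by (simp add: order_on_defs)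
  ultimately have "order_embedding snd (ordered_sum X I) X"
    using assms(2)
    by (auto simp: order_embedding_def inj_on_def Field_ordered_sum in_ordered_sum refl_on_def)
  then show ?thesis by (auto simp: embeds_iff)
qed

text \<open>A point \<open>i x\<close> picked in the summand at \<open>e x\<close> gives a copy of
  \<open>\<rho>\<close> running through the sum.\<close>

lemma index_embeds_ordered_sum:
  assumes e: "order_embedding e \<rho> X"
    and i: "\<And>x. x \<in> Field \<rho> \<Longrightarrow> (i x, i x) \<in> I (e x)" and "Refl \<rho>"
  shows "\<rho> \<lesssim>\<^sub>o ordered_sum X I"
proof -
  have "order_embedding (\<lambda>x. (i x, e x)) \<rho> (ordered_sum X I)"
    using i FieldI1[OF i] order_embeddingD[OF e] \<open>Refl \<rho>\<close>
    by (auto simp: order_embedding_def inj_on_def Field_ordered_sum in_ordered_sum refl_on_def)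
  then show ?thesis by (auto simp: embeds_iff)
qed

subsection \<open>Finite condensation classes\<close>

lemma no_finite_F_classes_iff:
  "no_finite_F_classes X \<longleftrightarrow> (\<forall>x\<in>Field X. infinite {y. (x, y) \<in> finite_condensation X})"
proof -
  have "finite_condensation X `` {x} = {y. (x, y) \<in> finite_condensation X}" for x by auto
  then show ?thesis by (simp add: no_finite_F_classes_def quotient_def)
qed

lemma no_finite_F_classes_converse:
  assumes "no_finite_F_classes X"
  shows "no_finite_F_classes (X\<inverse>)"
proof -
  have "finite_condensation (X\<inverse>) = finite_condensation X"
    unfolding finite_condensation_def by (auto simp: conj_commute)
  with assms show ?thesis
    by (simp add: no_finite_F_classes_def)
qed

text \<open>Convexity of the image makes every interval between image points the image of an
  interval of \<open>r\<close>, so finite intervals stay finite and \<open>f\<close> injects the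
  class of \<open>x\<close> into that of \<open>f x\<close>. This covers isomorphisms as well as the
  inclusion of one summand into a sum.\<close>

lemma infinite_F_class_embedding:
  assumes f: "order_embedding f r s" and x: "x \<in> Field r"
    and inf: "infinite {y. (x, y) \<in> finite_condensation r}"
    and convex: "\<And>u v z. u \<in> Field r \<Longrightarrow> v \<in> Field r \<Longrightarrow> (f u, z) \<in> s \<Longrightarrow> (z, f v) \<in> s
                  \<Longrightarrow> z \<in> f ` Field r"
  shows "infinite {y. (f x, y) \<in> finite_condensation s}"
proof -
  have "f ` {y. (x, y) \<in> finite_condensation r} \<subseteq> {y. (f x, y) \<in> finite_condensation s}"
  proof (intro image_subsetI CollectI, unfold mem_Collect_eq)
    fix y assume y: "(x, y) \<in> finite_condensation r"
    then have yF: "y \<in> Field r" by (simp add: finite_condensation_def)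
    have "{z. (f u, z) \<in> s \<and> (z, f v) \<in> s} \<subseteq> f ` {z. (u, z) \<in> r \<and> (z, v) \<in> r}"
      if uv: "u \<in> Field r" "v \<in> Field r" for u v
    proof clarify
      fix z assume z: "(f u, z) \<in> s" "(z, f v) \<in> s"
      then obtain w where "w \<in> Field r" "z = f w" using convex uv by blast
      with z uv show "z \<in> f ` {z. (u, z) \<in> r \<and> (z, v) \<in> r}"
        by (auto simp: order_embeddingD(2)[OF f])
    qed
    from this[OF x yF] this[OF yF x]
    have "finite ({z. (f x, z) \<in> s \<and> (z, f y) \<in> s} \<union> {z. (f y, z) \<in> s \<and> (z, f x) \<in> s})"
      using y by (auto simp: finite_condensation_def intro: finite_subset)
    then show "(f x, f y) \<in> finite_condensation s"
      using order_embeddingD(1)[OF f x] order_embeddingD(1)[OF f yF]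
      by (simp add: finite_condensation_def)
  qed
  moreover have "inj_on f {y. (x, y) \<in> finite_condensation r}"
    using f by (auto simp: order_embedding_def finite_condensation_def intro: inj_on_subset)
  ultimately show ?thesis using inf by (meson finite_imageD finite_subset)
qed

lemma no_finite_F_classes_iso:
  assumes "iso r s f" "no_finite_F_classes r"
  shows "no_finite_F_classes s"
proof -
  have im: "f ` Field r = Field s" using assms(1) by (simp add: iso_iff2 bij_betw_def)
  have "infinite {y. (f x, y) \<in> finite_condensation s}" if "x \<in> Field r" for x
    using infinite_F_class_embedding[OF iso_order_embedding[OF assms(1)] that] assms(2) that im
    by (auto simp: no_finite_F_classes_iff intro: FieldI1)
  then show ?thesis unfolding no_finite_F_classes_iff im[symmetric] by auto
qed

lemma no_finite_F_classes_ordered_sum: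
  assumes X: "antisym X" and I: "\<And>x. x \<in> Field X \<Longrightarrow> no_finite_F_classes (I x)"
  shows "no_finite_F_classes (ordered_sum X I)"
  unfolding no_finite_F_classes_iff
proof
  fix p assume "p \<in> Field (ordered_sum X I)"
  then obtain i x where p: "p = (i, x)" "x \<in> Field X" "i \<in> Field (I x)"
    by (auto simp: Field_ordered_sum)
  have e: "order_embedding (\<lambda>i. (i, x)) (I x) (ordered_sum X I)"
    using p by (auto simp: order_embedding_def inj_on_def Field_ordered_sum in_ordered_sum)
  \<comment> \<open>A summand is convex: the index of \<open>z\<close> lies both above and below
    \<open>x\<close>.\<close>
  have "z \<in> (\<lambda>i. (i, x)) ` Field (I x)"
    if "((u, x), z) \<in> ordered_sum X I" "(z, (v, x)) \<in> ordered_sum X I" for u v z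
    using that X by (cases z) (auto simp: in_ordered_sum antisym_def)
  then show "infinite {y. (p, y) \<in> finite_condensation (ordered_sum X I)}"
    using infinite_F_class_embedding[OF e p(3)] I[OF p(2)] p
    by (auto simp: no_finite_F_classes_iff)
qed

section \<open>Well-orders without a last element\<close>

lemma finite_linear_greatest:
  assumes "finite A" "A \<noteq> {}" "A \<subseteq> Field r" "Linear_order r"
  shows "\<exists>m\<in>A. \<forall>y\<in>A. (y, m) \<in> r"
  using assms(1-3)
proof (induction rule: finite_ne_induct)
  case (singleton a)
  then show ?case using assms(4) by (auto simp: order_on_defs refl_on_def)
next
  case (insert a A)
  then obtain m where m: "m \<in> A" "\<forall>y\<in>A. (y, m) \<in> r" by auto
  have r: "trans r" "Refl r" "Total r" using assms(4) by (auto simp: order_on_defs)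
  show ?case
  proof (cases "(a, m) \<in> r")
    case True
    with m show ?thesis by auto
  next
    case False
    moreover have "(a, a) \<in> r" "(m, m) \<in> r"
      using insert.prems m(1) r(2) by (auto simp: refl_on_def)
    ultimately have "(m, a) \<in> r"
      using insert.prems m(1) r(3) by (auto simp: total_on_def)
    with m \<open>(a, a) \<in> r\<close> r(1) show ?thesis by (blast intro: transD)
  qed
qed

text \<open>If the class of \<open>x\<close> were finite, its part above \<open>x\<close> would have
  a greatest element \<open>m\<close>. The immediate successor of \<open>m\<close> is still only
  finitely far from \<open>x\<close>, a contradiction.\<close>

lemma no_finite_F_classes_Well_order:
  assumes wo: "Well_order r" and nomax: "\<And>x. x \<in> Field r \<Longrightarrow> \<exists>y\<in>Field r. x \<noteq> y \<and> (x, y) \<in> r"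
  shows "no_finite_F_classes r"
  unfolding no_finite_F_classes_iff
proof (intro ballI notI)
  fix x assume x: "x \<in> Field r" and fin: "finite {y. (x, y) \<in> finite_condensation r}"
  interpret wo_rel r by (simp add: wo_rel_def wo)
  have tr: "trans r" and an: "antisym r" and rf: "Refl r" and tot: "Total r"
    using LIN by (auto simp: order_on_defs)
  define A where "A = {y. (x, y) \<in> finite_condensation r \<and> (x, y) \<in> r}"
  have "{z. (x, z) \<in> r \<and> (z, x) \<in> r} \<subseteq> {x}" using an by (auto simp: antisym_def)
  then have "x \<in> A" using x rf
    by (auto simp: A_def finite_condensation_def refl_on_def intro: finite_subset)
  moreover have "finite A" using fin by (auto simp: A_def)
  moreover have "A \<subseteq> Field r" by (auto simp: A_def intro: FieldI2)
  ultimately obtain m where m: "m \<in> A" "\<And>y. y \<in> A \<Longrightarrow> (y, m) \<in> r"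
    using finite_linear_greatest[of A r] LIN by blast
  then have mF: "m \<in> Field r" and xm: "(x, m) \<in> r" by (auto simp: A_def intro: FieldI2)
  define B where "B = {y \<in> Field r. m \<noteq> y \<and> (m, y) \<in> r}"
  have B: "B \<subseteq> Field r" "B \<noteq> {}" using nomax[OF mF] by (auto simp: B_def)
  \<comment> \<open>The immediate successor of \<open>m\<close>, which exists because
    \<open>m\<close> is not last.\<close>
  define s where "s = minim B"
  have s: "s \<in> B" "\<And>y. y \<in> B \<Longrightarrow> (s, y) \<in> r"
    using minim_in[OF B] minim_least[OF B(1)] by (auto simp: s_def)
  have xs: "(x, s) \<in> r" using xm s(1) tr by (auto simp: B_def trans_def)
  have "s \<notin> A" using s(1) m an by (auto simp: B_def antisym_def)
  \<comment> \<open>By minimality of \<open>s\<close> nothing lies strictly between \<open>m\<close>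
    and \<open>s\<close>, so only \<open>s\<close> is added to a finite interval.\<close>
  have "{z. (x, z) \<in> r \<and> (z, s) \<in> r} \<subseteq> insert s {z. (x, z) \<in> r \<and> (z, m) \<in> r}"
  proof
    fix z assume "z \<in> {z. (x, z) \<in> r \<and> (z, s) \<in> r}"
    then have z: "(x, z) \<in> r" "(z, s) \<in> r" by auto
    show "z \<in> insert s {z. (x, z) \<in> r \<and> (z, m) \<in> r}"
    proof (cases "(z, m) \<in> r")
      case False
      have zF: "z \<in> Field r" using z by (auto intro: FieldI2)
      with False mF tot rf have "m \<noteq> z" "(m, z) \<in> r"
        unfolding total_on_def refl_on_def by metis+
      with zF have "z \<in> B" by (simp add: B_def)
      with s(2) z(2) an have "z = s" by (meson antisymD)
      then show ?thesis by simp
    qed (use z in simp)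
  qed
  moreover have "{z. (s, z) \<in> r \<and> (z, x) \<in> r} \<subseteq> {x}"
  proof
    fix z assume "z \<in> {z. (s, z) \<in> r \<and> (z, x) \<in> r}"
    then have z: "(s, z) \<in> r" "(z, x) \<in> r" by auto
    then have "(x, z) \<in> r" using xs tr by (meson transD)
    with z an show "z \<in> {x}" by (auto dest: antisymD)
  qed
  moreover have "finite {z. (x, z) \<in> r \<and> (z, m) \<in> r}"
    using m(1) by (auto simp: A_def finite_condensation_def)
  ultimately have "finite {z. (x, z) \<in> r \<and> (z, s) \<in> r}" "finite {z. (s, z) \<in> r \<and> (z, x) \<in> r}"
    by (meson finite_insert finite_subset finite.emptyI)+
  with xs x s(1) have "s \<in> A" by (simp add: A_def B_def finite_condensation_def)
  with \<open>s \<notin> A\<close> show False ..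
qed

section \<open>Thick orders, with the witness on the same universe\<close>

definition thick :: "'a rel \<Rightarrow> bool" where
  "thick \<phi> \<longleftrightarrow> (\<exists>\<psi> :: 'a rel. Linear_order \<psi> \<and> \<phi> \<equiv>\<^sub>o \<psi> \<and> no_finite_F_classes \<psi>)"

lemma thick_empty: "Field \<phi> = {} \<Longrightarrow> thick \<phi>"
  unfolding thick_def
  by (intro exI[of _ "{}"]) (simp add: empty_equimorphic no_finite_F_classes_iff)

lemma thick_equimorphic:
  fixes \<phi> \<psi> :: "'a rel"
  shows "\<phi> \<equiv>\<^sub>o \<psi> \<Longrightarrow> thick \<psi> \<Longrightarrow> thick \<phi>"
  unfolding thick_def using equimorphic_trans by blast

text \<open>Sums live on pairs, whereas \<open>thick\<close> asks for a witness on
  \<open>'u\<close>. A bijection between \<open>'u \<times> 'u\<close> and the infinite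
  \<open>'u\<close> copies the witness back.\<close>

lemma thick_pair:
  fixes \<phi> :: "'u rel" and \<chi> :: "('u \<times> 'u) rel"
  assumes "infinite (UNIV :: 'u set)" "\<phi> \<equiv>\<^sub>o \<chi>" "Linear_order \<chi>" "no_finite_F_classes \<chi>"
  shows "thick \<phi>"
proof -
  have "|(UNIV :: 'u set) \<times> (UNIV :: 'u set)| =o |UNIV :: 'u set|"
    using card_of_Times_same_infinite[OF assms(1)] .
  then obtain f :: "'u \<times> 'u \<Rightarrow> 'u" where "bij f"
    unfolding card_of_ordIso[symmetric] by auto
  then have inj: "inj_on f (Field \<chi>)" by (auto simp: bij_def intro: inj_on_subset)
  note i = dir_image_iso'[OF inj]
  show ?thesis
    unfolding thick_def
    using Linear_order_dir_image[OF assms(3) inj] no_finite_F_classes_iso[OF i assms(4)]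
      equimorphic_trans[OF assms(2) iso_imp_equimorphic[OF i]] by blast
qed

subsection \<open>Redistributing the summands\<close>

text \<open>The map \<open>c\<close> prescribes which summand is wanted at each position;
  \<open>e\<close> moves the position to one where a summand at least as large is available.
  Positions outside the range of \<open>e\<close> are simply skipped.\<close>

definition redistributable :: "'b rel \<Rightarrow> ('b \<Rightarrow> 'a rel) \<Rightarrow> bool" where
  "redistributable \<rho> \<psi> \<longleftrightarrow>
     (\<forall>c. c ` Field \<rho> \<subseteq> Field \<rho> \<longrightarrow>
        (\<exists>e. order_embedding e \<rho> \<rho> \<and> (\<forall>x\<in>Field \<rho>. \<psi> (c x) \<lesssim>\<^sub>o \<psi> (e x))))"

lemma thick_redistributable_sum:
  fixes \<rho> \<phi> :: "'u rel" and \<psi> :: "'u \<Rightarrow> 'u rel"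
  assumes inf: "infinite (UNIV :: 'u set)" and lin: "Linear_order \<rho>" and th: "thick \<rho>"
    and \<psi>: "\<And>x. x \<in> Field \<rho> \<Longrightarrow> (\<exists>a. \<psi> x = {(a, a)}) \<or> thick (\<psi> x)"
    and red: "redistributable \<rho> \<psi>" and \<phi>: "\<phi> \<equiv>\<^sub>o ordered_sum \<rho> \<psi>"
  shows "thick \<phi>"
proof (cases "\<exists>k\<in>Field \<rho>. Field (\<psi> k) \<noteq> {} \<and> thick (\<psi> k)")
  case True
  then obtain k where k: "k \<in> Field \<rho>" "Field (\<psi> k) \<noteq> {}" "thick (\<psi> k)" by auto
  \<comment> \<open>Positions with a thick summand keep it; at the others the summand is
    \<open>1\<close> and is to be replaced by \<open>\<psi> k\<close>. Hence each
    \<open>\<psi> (c x)\<close> is thick, and \<open>\<tau> x\<close> below is a witness for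
    it.\<close>
  define c where "c x = (if thick (\<psi> x) then x else k)" for x
  have cF: "c ` Field \<rho> \<subseteq> Field \<rho>" using k by (auto simp: c_def)
  have "\<exists>\<tau> :: 'u rel. Linear_order \<tau> \<and> \<psi> (c x) \<equiv>\<^sub>o \<tau> \<and> no_finite_F_classes \<tau>" for x
    using k(3) unfolding thick_def[symmetric] c_def by (cases "thick (\<psi> x)") simp_all
  then obtain \<tau> where \<tau>: "\<And>x. Linear_order (\<tau> x :: 'u rel)" "\<And>x. \<psi> (c x) \<equiv>\<^sub>o \<tau> x"
      "\<And>x. no_finite_F_classes (\<tau> x)"
    by metis
  have "\<psi> x \<lesssim>\<^sub>o \<tau> x" if x: "x \<in> Field \<rho>" for x
  proof (cases "thick (\<psi> x)")
    case True
    then show ?thesis using \<tau>(2)[of x] by (simp add: c_def equimorphic_def)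
  next
    case False
    then have "\<psi> k \<lesssim>\<^sub>o \<tau> x" using \<tau>(2)[of x] by (simp add: c_def equimorphic_def)
    then have "Field (\<tau> x) \<noteq> {}" using k(2) embeds_empty_Field by blast
    moreover have "Refl (\<tau> x)" using \<tau>(1) by (simp add: order_on_defs)
    ultimately show ?thesis using False \<psi>[OF x] singleton_embeds by metis
  qed
  moreover have "order_embedding id \<rho> \<rho>" by (simp add: order_embedding_def)
  ultimately have "ordered_sum \<rho> \<psi> \<lesssim>\<^sub>o ordered_sum \<rho> \<tau>"
    using ordered_sum_embeds[of id \<rho> \<rho> \<psi> \<tau>] by simp
  moreover obtain e where "order_embedding e \<rho> \<rho>" "\<forall>x\<in>Field \<rho>. \<psi> (c x) \<lesssim>\<^sub>o \<psi> (e x)"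
    using red[unfolded redistributable_def, rule_format, OF cF] by blast
  \<comment> \<open>Enlarging the summands costs nothing, as \<open>\<tau> x\<close> embeds in
    \<open>\<psi> (c x)\<close> and hence in \<open>\<psi> (e x)\<close>.\<close>
  then have "ordered_sum \<rho> \<tau> \<lesssim>\<^sub>o ordered_sum \<rho> \<psi>"
    using \<tau>(2) embeds_trans unfolding equimorphic_def by (metis ordered_sum_embeds)
  ultimately have "\<phi> \<equiv>\<^sub>o ordered_sum \<rho> \<tau>"
    using equimorphic_trans[OF \<phi>, of "ordered_sum \<rho> \<tau>"] by (simp add: equimorphic_def)
  moreover have "antisym \<rho>" using lin by (simp add: order_on_defs)
  ultimately show ?thesis
    using thick_pair[OF inf] Linear_order_ordered_sum[OF lin, of \<tau>]
      no_finite_F_classes_ordered_sum[of \<rho> \<tau>] \<tau> by blast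
next
  case False
  then have small: "Field (\<psi> x) = {} \<or> (\<exists>a. \<psi> x = {(a, a)})" if "x \<in> Field \<rho>" for x
    using \<psi>[OF that] that by auto
  show ?thesis
  proof (cases "\<exists>k\<in>Field \<rho>. \<exists>a. \<psi> k = {(a, a)}")
    case True
    then obtain k a where k: "k \<in> Field \<rho>" "\<psi> k = {(a, a)}" by auto
    \<comment> \<open>The constant map \<open>c\<close> asks for a nonempty summand at every
      position, so that \<open>\<rho>\<close> itself embeds in the sum.\<close>
    then have "(\<lambda>_. k) ` Field \<rho> \<subseteq> Field \<rho>" by auto
    then obtain e where e: "order_embedding e \<rho> \<rho>" "\<forall>x\<in>Field \<rho>. {(a, a)} \<lesssim>\<^sub>o \<psi> (e x)"
      using red[unfolded redistributable_def, rule_format, of "\<lambda>_. k"] k(2) by auto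
    have "\<exists>i. (i, i) \<in> \<psi> (e x)" if "x \<in> Field \<rho>" for x
      using e(2) that by (auto simp: embeds_def Field_def)
    then obtain i where "\<And>x. x \<in> Field \<rho> \<Longrightarrow> (i x, i x) \<in> \<psi> (e x)" by metis
    moreover have "Refl \<rho>" using lin by (simp add: order_on_defs)
    ultimately have "\<rho> \<lesssim>\<^sub>o ordered_sum \<rho> \<psi>" using index_embeds_ordered_sum[OF e(1)] by blast
    moreover have "ordered_sum \<rho> \<psi> \<lesssim>\<^sub>o \<rho>"
    proof (rule ordered_sum_embeds_index[OF lin])
      fix x i j assume "x \<in> Field \<rho>" "i \<in> Field (\<psi> x)" "j \<in> Field (\<psi> x)"
      with small[of x] show "i = j" by (auto simp: Field_def)
    qed
    ultimately have "\<phi> \<equiv>\<^sub>o \<rho>" using equimorphic_trans[OF \<phi>, of \<rho>] by (simp add: equimorphic_def)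
    then show ?thesis using th thick_equimorphic by blast
  next
    case False
    then have "Field (ordered_sum \<rho> \<psi>) = {}" using small by (auto simp: Field_ordered_sum)
    then have "Field \<phi> = {}" using \<phi> embeds_empty_Field by (auto simp: equimorphic_def)
    then show ?thesis by (rule thick_empty)
  qed
qed

subsection \<open>Regular cardinals\<close>

lemma infinite_regular_cardinal_Linear_order: "infinite_regular_cardinal \<kappa> \<Longrightarrow> Linear_order \<kappa>"
  using card_order_on_well_order_on
  by (auto simp: infinite_regular_cardinal_def well_order_on_def)

text \<open>Transfinite recursion: fewer than \<open>\<kappa>\<close> values have been chosen before
  \<open>x\<close>, so by regularity they are bounded, and the cofinal set \<open>S x\<close>
  contains a point beyond the bound.\<close>

lemma regular_strict_selection:
  fixes \<kappa> :: "'a rel"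
  assumes reg: "infinite_regular_cardinal \<kappa>"
    and S: "\<And>x. x \<in> Field \<kappa> \<Longrightarrow> S x \<subseteq> Field \<kappa> \<and> cofinal (S x) \<kappa>"
  shows "\<exists>e. \<forall>x\<in>Field \<kappa>. e x \<in> S x \<and> (\<forall>y. (y, x) \<in> \<kappa> \<and> y \<noteq> x \<longrightarrow> (e y, e x) \<in> \<kappa> \<and> e y \<noteq> e x)"
proof -
  have card: "Card_order \<kappa>" and rc: "regularCard \<kappa>"
    using reg by (auto simp: infinite_regular_cardinal_def)
  then have wo: "Well_order \<kappa>" by (simp add: card_order_on_well_order_on)
  then have \<kappa>: "trans \<kappa>" "antisym \<kappa>" "Total \<kappa>" "Refl \<kappa>" "wf (\<kappa> - Id)" by (auto simp: order_on_defs)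
  have "\<exists>e. \<forall>x. x \<in> Field \<kappa> \<longrightarrow>
      e x \<in> S x \<and> (\<forall>y. (y, x) \<in> \<kappa> - Id \<longrightarrow> (e y, e x) \<in> \<kappa> - Id)"
  \<comment> \<open>The first goal says that the requirement at \<open>x\<close> depends only on the
    values below \<open>x\<close>; the second provides an admissible value.\<close>
  proof (rule dependent_wf_choice[OF \<kappa>(5)])
    fix f g :: "'a \<Rightarrow> 'a" and x r assume "\<And>z. (z, x) \<in> \<kappa> - Id \<Longrightarrow> f z = g z"
    then show "(x \<in> Field \<kappa> \<longrightarrow> r \<in> S x \<and> (\<forall>y. (y, x) \<in> \<kappa> - Id \<longrightarrow> (f y, r) \<in> \<kappa> - Id)) =
      (x \<in> Field \<kappa> \<longrightarrow> r \<in> S x \<and> (\<forall>y. (y, x) \<in> \<kappa> - Id \<longrightarrow> (g y, r) \<in> \<kappa> - Id))"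
      by auto
  next
    fix x and f :: "'a \<Rightarrow> 'a"
    assume IH: "\<And>y. (y, x) \<in> \<kappa> - Id \<Longrightarrow> y \<in> Field \<kappa> \<longrightarrow>
        f y \<in> S y \<and> (\<forall>z. (z, y) \<in> \<kappa> - Id \<longrightarrow> (f z, f y) \<in> \<kappa> - Id)"
    show "\<exists>r. x \<in> Field \<kappa> \<longrightarrow> r \<in> S x \<and> (\<forall>y. (y, x) \<in> \<kappa> - Id \<longrightarrow> (f y, r) \<in> \<kappa> - Id)"
    proof (cases "x \<in> Field \<kappa>")
      case x: True
      let ?K = "f ` underS \<kappa> x"
      have K: "?K \<subseteq> Field \<kappa>"
        using IH S by (force simp: underS_def dest: FieldI1)
      have "|?K| <o \<kappa>"
        using card_of_underS[OF card x] card_of_image ordLeq_ordLess_trans by blast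
      \<comment> \<open>\<open>regularCard\<close> says that cofinal subsets have full cardinality,
        so the smaller set \<open>?K\<close> has an upper bound \<open>a\<close>.\<close>
      then have "\<not> |?K| =o \<kappa>" using not_ordLess_ordIso by blast
      then have "\<not> cofinal ?K \<kappa>" using rc K by (auto simp: regularCard_def)
      then obtain a where a: "a \<in> Field \<kappa>" "\<And>b. b \<in> ?K \<Longrightarrow> a = b \<or> (a, b) \<notin> \<kappa>"
        by (auto simp: cofinal_def)
      obtain r where r: "r \<in> S x" "a \<noteq> r" "(a, r) \<in> \<kappa>"
        using S[OF x] a(1) by (auto simp: cofinal_def)
      have "(f y, r) \<in> \<kappa> - Id" if y: "(y, x) \<in> \<kappa> - Id" for y
      proof -
        have fy: "f y \<in> ?K" using y by (auto simp: underS_def)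
        then have "f y \<in> Field \<kappa>" "a = f y \<or> (a, f y) \<notin> \<kappa>" using K a(2) by blast+
        with a(1) \<kappa>(3,4) have "(f y, a) \<in> \<kappa>" unfolding total_on_def refl_on_def by metis
        with r \<kappa>(1,2) show ?thesis unfolding trans_def antisym_def by blast
      qed
      with r(1) show ?thesis by blast
    qed auto
  qed
  then show ?thesis by auto
qed

lemma regular_no_finite_F_classes:
  assumes "infinite_regular_cardinal \<kappa>"
  shows "no_finite_F_classes \<kappa>"
proof (rule no_finite_F_classes_Well_order)
  show "Well_order \<kappa>"
    using assms by (simp add: infinite_regular_cardinal_def card_order_on_well_order_on)
  show "\<And>x. x \<in> Field \<kappa> \<Longrightarrow> \<exists>y\<in>Field \<kappa>. x \<noteq> y \<and> (x, y) \<in> \<kappa>"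
    using assms infinite_Card_order_limit by (fastforce simp: infinite_regular_cardinal_def)
qed

lemma thick_regular:
  assumes "infinite_regular_cardinal \<kappa>"
  shows "thick \<kappa>" and "thick (\<kappa>\<inverse>)"
proof -
  have "Linear_order \<kappa>" "Linear_order (\<kappa>\<inverse>)"
    using infinite_regular_cardinal_Linear_order[OF assms] by simp_all
  then show "thick \<kappa>" "thick (\<kappa>\<inverse>)"
    using regular_no_finite_F_classes[OF assms] no_finite_F_classes_converse equimorphic_refl
    unfolding thick_def by blast+
qed

text \<open>The positions whose summand is at least \<open>\<psi> (c x)\<close> form a cofinal set,
  from which the strict selection draws \<open>e x\<close>.\<close>

lemma redistributable_unbounded_sum:
  assumes "regular_unbounded_sum \<rho> \<psi>"
  shows "redistributable \<rho> \<psi>"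
  unfolding redistributable_def
proof (intro allI impI)
  fix c assume c: "c ` Field \<rho> \<subseteq> Field \<rho>"
  have reg: "infinite_regular_cardinal \<rho>" using assms by (simp add: regular_unbounded_sum_def)
  then have lin: "Linear_order \<rho>" by (rule infinite_regular_cardinal_Linear_order)
  obtain e where e: "\<forall>x\<in>Field \<rho>. e x \<in> {\<beta> \<in> Field \<rho>. \<psi> (c x) \<lesssim>\<^sub>o \<psi> \<beta>} \<and>
      (\<forall>y. (y, x) \<in> \<rho> \<and> y \<noteq> x \<longrightarrow> (e y, e x) \<in> \<rho> \<and> e y \<noteq> e x)"
    using regular_strict_selection[OF reg, of "\<lambda>x. {\<beta> \<in> Field \<rho>. \<psi> (c x) \<lesssim>\<^sub>o \<psi> \<beta>}"] assms c
    by (auto simp: regular_unbounded_sum_def)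
  have "order_embedding e \<rho> \<rho>"
    using lin e by (intro strict_mono_order_embedding) (auto simp: order_on_defs intro: FieldI2)
  with e show "\<exists>e. order_embedding e \<rho> \<rho> \<and> (\<forall>x\<in>Field \<rho>. \<psi> (c x) \<lesssim>\<^sub>o \<psi> (e x))" by auto
qed

text \<open>Reversing the index leaves its self-embeddings and the comparisons of summands
  unchanged, which reduces \<open>\<kappa>\<^sup>*\<close>-sums to
  \<open>\<kappa>\<close>-sums.\<close>

lemma redistributable_converse: "redistributable (\<rho>\<inverse>) \<psi> \<longleftrightarrow> redistributable \<rho> \<psi>"
proof -
  have "order_embedding e (\<rho>\<inverse>) (\<rho>\<inverse>) \<longleftrightarrow> order_embedding e \<rho> \<rho>" for e
    by (auto simp: order_embedding_def)
  then show ?thesis by (simp add: redistributable_def)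
qed

subsection \<open>Orders equimorphic to their square\<close>

text \<open>The interval from \<open>a\<close> to \<open>b\<close> in the copy of
  \<open>\<rho>\<close> with index \<open>x\<close> is sent into \<open>\<rho>\<close>; different
  copies follow each other in the order of their indices.\<close>

lemma square_disjoint_intervals:
  assumes sq: "ordered_square \<rho> \<lesssim>\<^sub>o \<rho>" and a: "a \<in> Field \<rho>" and b: "b \<in> Field \<rho>"
    and ab: "(a, b) \<in> \<rho>" "a \<noteq> b"
  obtains u v where "\<And>x. x \<in> Field \<rho> \<Longrightarrow> (u x, v x) \<in> \<rho> \<and> u x \<noteq> v x"
    and "\<And>x y. (x, y) \<in> \<rho> \<Longrightarrow> x \<noteq> y \<Longrightarrow> (v x, u y) \<in> \<rho> \<and> v x \<noteq> u y"
proof -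
  obtain f where f: "order_embedding f (ordered_square \<rho>) \<rho>" using sq by (auto simp: embeds_iff)
  have F: "(i, x) \<in> Field (ordered_square \<rho>)" if "i \<in> Field \<rho>" "x \<in> Field \<rho>" for i x
    using that by (simp add: ordered_square_def Field_ordered_sum)
  show ?thesis
  proof
    show "(f (a, x), f (b, x)) \<in> \<rho> \<and> f (a, x) \<noteq> f (b, x)" if "x \<in> Field \<rho>" for x
      using order_embeddingD(2,3)[OF f F F] a b ab that
      by (simp add: ordered_square_def in_ordered_sum)
    show "(f (b, x), f (a, y)) \<in> \<rho> \<and> f (b, x) \<noteq> f (a, y)" if "(x, y) \<in> \<rho>" "x \<noteq> y" for x y
      using order_embeddingD(2,3)[OF f F F] a b that FieldI1[OF that(1)] FieldI2[OF that(1)]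
      by (simp add: ordered_square_def in_ordered_sum)
  qed
qed

lemma square_increasing_sequence:
  assumes lin: "Linear_order \<rho>" and sq: "ordered_square \<rho> \<lesssim>\<^sub>o \<rho>"
    and a: "a \<in> Field \<rho>" and b: "b \<in> Field \<rho>" and ab: "(a, b) \<in> \<rho>" "a \<noteq> b"
  obtains s :: "nat \<Rightarrow> 'a" where "order_embedding s natLeq \<rho>"
proof -
  obtain f where f: "order_embedding f (ordered_square \<rho>) \<rho>" using sq by (auto simp: embeds_iff)
  have F: "(i, x) \<in> Field (ordered_square \<rho>)" if "i \<in> Field \<rho>" "x \<in> Field \<rho>" for i x
    using that by (simp add: ordered_square_def Field_ordered_sum)
  \<comment> \<open>A strictly increasing self-map with values in the image of the copy with index
    \<open>b\<close>.\<close>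
  define g where "g i = f (i, b)" for i
  have gF: "g i \<in> Field \<rho>" if "i \<in> Field \<rho>" for i
    using order_embeddingD(1)[OF f F] that b by (simp add: g_def)
  have g: "(g i, g j) \<in> \<rho> \<and> g i \<noteq> g j" if "(i, j) \<in> \<rho>" "i \<noteq> j" for i j
    using order_embeddingD(2,3)[OF f F F] b that FieldI1[OF that(1)] FieldI2[OF that(1)]
    by (simp add: ordered_square_def in_ordered_sum g_def)
  \<comment> \<open>The start lies in the image of the earlier copy with index \<open>a\<close>,
    hence below every value of \<open>g\<close>. So \<open>s 0\<close> is below
    \<open>g (s 0)\<close>, and iterating \<open>g\<close> preserves this.\<close>
  define s where "s n = (g ^^ n) (f (a, a))" for n
  have sF: "s n \<in> Field \<rho>" for n
    by (induction n) (use order_embeddingD(1)[OF f F] a gF in \<open>auto simp: s_def\<close>)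
  have step: "(s n, s (Suc n)) \<in> \<rho> \<and> s n \<noteq> s (Suc n)" for n
  proof (induction n)
    case 0
    have "f (a, a) \<in> Field \<rho>" using order_embeddingD(1)[OF f F] a by simp
    then show ?case
      using order_embeddingD(2,3)[OF f F F] a b ab
      by (simp add: s_def g_def ordered_square_def in_ordered_sum)
  next
    case (Suc n)
    then show ?case using g by (simp add: s_def)
  qed
  have tr: "trans \<rho>" and an: "antisym \<rho>" and "Refl \<rho>" using lin by (auto simp: order_on_defs)
  have mono: "(s m, s n) \<in> \<rho> \<and> s m \<noteq> s n" if "m < n" for m n
    using that
  proof (induction rule: less_Suc_induct)
    case (1 i)
    then show ?case by (rule step)
  next
    case (2 i j k)
    then show ?case using tr an unfolding trans_def antisym_def by metis
  qed
  have "order_embedding s natLeq \<rho>"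
  proof (rule strict_mono_order_embedding)
    show "Linear_order natLeq" using natLeq_Linear_order by simp
    show "(s x, s y) \<in> \<rho> \<and> s x \<noteq> s y" if "(x, y) \<in> natLeq" "x \<noteq> y" for x y
      using mono that by (auto simp: natLeq_def)
  qed (use an \<open>Refl \<rho>\<close> sF in auto)
  then show ?thesis using that by blast
qed

text \<open>Density supplies, in the interval attached to \<open>x\<close>, a position whose summand
  is at least \<open>\<psi> (c x)\<close>.\<close>

lemma redistributable_shuffle_sum:
  assumes lin: "Linear_order \<rho>" and sq: "ordered_square \<rho> \<lesssim>\<^sub>o \<rho>"
    and ab: "a \<in> Field \<rho>" "b \<in> Field \<rho>" "(a, b) \<in> \<rho>" "a \<noteq> b"
    and sh: "shuffle_sum \<rho> \<psi>"
  shows "redistributable \<rho> \<psi>"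
  unfolding redistributable_def
proof (intro allI impI)
  fix c assume c: "c ` Field \<rho> \<subseteq> Field \<rho>"
  obtain u v where uv: "\<And>x. x \<in> Field \<rho> \<Longrightarrow> (u x, v x) \<in> \<rho> \<and> u x \<noteq> v x"
    and vu: "\<And>x y. (x, y) \<in> \<rho> \<Longrightarrow> x \<noteq> y \<Longrightarrow> (v x, u y) \<in> \<rho> \<and> v x \<noteq> u y"
    using square_disjoint_intervals[OF sq ab] by blast
  have "\<exists>z\<in>Field \<rho>. \<psi> (c x) \<lesssim>\<^sub>o \<psi> z \<and> (u x, z) \<in> \<rho> \<and> (z, v x) \<in> \<rho>" if "x \<in> Field \<rho>" for x
  proof -
    have "dense_subset {y \<in> Field \<rho>. \<psi> (c x) \<lesssim>\<^sub>o \<psi> y} \<rho>"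
      using sh c that by (auto simp: shuffle_sum_def)
    then show ?thesis using uv[OF that] unfolding dense_subset_def by blast
  qed
  then obtain e where e: "\<And>x. x \<in> Field \<rho> \<Longrightarrow>
      e x \<in> Field \<rho> \<and> \<psi> (c x) \<lesssim>\<^sub>o \<psi> (e x) \<and> (u x, e x) \<in> \<rho> \<and> (e x, v x) \<in> \<rho>"
    by metis
  have "order_embedding e \<rho> \<rho>"
  proof (rule strict_mono_order_embedding[OF lin])
    have \<rho>: "trans \<rho>" "antisym \<rho>" using lin by (auto simp: order_on_defs)
    show "(e x, e y) \<in> \<rho> \<and> e x \<noteq> e y" if xy: "(x, y) \<in> \<rho>" "x \<noteq> y" for x y
    proof -
      \<comment> \<open>Density allows \<open>e x\<close> to be an endpoint, so strictness comes
        from the gap between \<open>v x\<close> and \<open>u y\<close>.\<close>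
      have "(e x, v x) \<in> \<rho>" "(v x, u y) \<in> \<rho>" "v x \<noteq> u y" "(u y, e y) \<in> \<rho>"
        using e[OF FieldI1[OF xy(1)]] e[OF FieldI2[OF xy(1)]] vu[OF xy] by auto
      with \<rho> show ?thesis unfolding trans_def antisym_def by metis
    qed
  qed (use lin e in \<open>auto simp: order_on_defs\<close>)
  with e show "\<exists>e. order_embedding e \<rho> \<rho> \<and> (\<forall>x\<in>Field \<rho>. \<psi> (c x) \<lesssim>\<^sub>o \<psi> (e x))" by auto
qed

text \<open>\<open>\<rho>\<close> embeds in the sum of \<open>\<rho>\<close> copies of
  \<open>\<omega>\<close>, this sum embeds in the square since \<open>\<omega>\<close> embeds in
  \<open>\<rho>\<close>, and the square embeds in \<open>\<rho>\<close>. The increasing sequence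
  also shows that the universe is infinite.\<close>

lemma thick_square:
  fixes \<rho> :: "'u rel"
  assumes lin: "Linear_order \<rho>" and sq: "ordered_square \<rho> \<lesssim>\<^sub>o \<rho>"
    and ab: "a \<in> Field \<rho>" "b \<in> Field \<rho>" "(a, b) \<in> \<rho>" "a \<noteq> b"
  shows "infinite (UNIV :: 'u set)" and "thick \<rho>"
proof -
  obtain s where s: "order_embedding s natLeq \<rho>"
    using square_increasing_sequence[OF lin sq ab] by blast
  then have inj: "inj s" by (simp add: order_embedding_def Field_natLeq)
  show inf: "infinite (UNIV :: 'u set)"
    using inj finite_UNIV_inj_surj infinite_UNIV_char_0 finite_imageD finite_subset subset_UNIV by metis
  have inj': "inj_on s (Field natLeq)" using inj by (simp add: Field_natLeq)
  \<comment> \<open>A copy of the natural numbers on \<open>'u\<close>, so that the sum has the type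
    that \<open>thick_pair\<close> expects.\<close>
  define \<omega> where "\<omega> = dir_image natLeq s"
  have i: "iso natLeq \<omega> s" unfolding \<omega>_def by (rule dir_image_iso'[OF inj'])
  have lin\<omega>: "Linear_order \<omega>"
    unfolding \<omega>_def using natLeq_Linear_order inj' by (simp add: Linear_order_dir_image)
  have "\<exists>y\<in>Field natLeq. x \<noteq> y \<and> (x, y) \<in> natLeq" for x
    by (rule bexI[of _ "Suc x"]) (auto simp: natLeq_def Field_natLeq[unfolded natLeq_def])
  then have "no_finite_F_classes natLeq"
    using no_finite_F_classes_Well_order natLeq_Well_order by blast
  then have nff: "no_finite_F_classes \<omega>" using no_finite_F_classes_iso[OF i] by blast
  have id: "order_embedding (\<lambda>x. x) \<rho> \<rho>" by (simp add: order_embedding_def)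
  have \<rho>: "Refl \<rho>" "antisym \<rho>" using lin by (auto simp: order_on_defs)
  have "(s 0, s 0) \<in> \<omega>" by (auto simp: \<omega>_def dir_image_def natLeq_def)
  then have "\<rho> \<lesssim>\<^sub>o ordered_sum \<rho> (\<lambda>_. \<omega>)"
    using index_embeds_ordered_sum[OF id, of "\<lambda>_. s 0" "\<lambda>_. \<omega>"] \<rho>(1) by simp
  moreover have "\<omega> \<lesssim>\<^sub>o \<rho>"
    using embeds_trans[of \<omega> natLeq \<rho>] iso_imp_equimorphic[OF i] s
    by (auto simp: equimorphic_def embeds_iff)
  then have "ordered_sum \<rho> (\<lambda>_. \<omega>) \<lesssim>\<^sub>o \<rho>"
    by (intro embeds_trans[OF ordered_sum_embeds[OF id] sq[unfolded ordered_square_def]])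
  ultimately have "\<rho> \<equiv>\<^sub>o ordered_sum \<rho> (\<lambda>_. \<omega>)" by (simp add: equimorphic_def)
  then show "thick \<rho>"
    by (rule thick_pair[OF inf])
      (simp_all add: Linear_order_ordered_sum no_finite_F_classes_ordered_sum lin \<rho> lin\<omega> nff)
qed

subsection \<open>The sum closure\<close>

text \<open>The order \<open>1\<close> is equimorphic to its square and may therefore index a
  shuffle; this settles that degenerate case.\<close>

lemma ordered_sum_singleton_equimorphic:
  assumes "Field \<rho> = {a}"
  shows "ordered_sum \<rho> \<psi> \<equiv>\<^sub>o \<psi> a"
proof -
  have "iso (ordered_sum \<rho> \<psi>) (\<psi> a) fst"
    using assms unfolding iso_iff2
    by (auto simp: Field_ordered_sum in_ordered_sum bij_betw_def inj_on_def image_iff)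
  then show ?thesis by (rule iso_imp_equimorphic)
qed

text \<open>Lets the alternative \<open>1\<close> in the induction pass along an
  equimorphism.\<close>

lemma equimorphic_singleton:
  assumes "\<phi> \<equiv>\<^sub>o {(a, a)}"
  shows "\<exists>b. \<phi> = {(b, b)}"
proof -
  obtain f where f: "order_embedding f \<phi> {(a, a)}"
    using assms by (auto simp: equimorphic_def embeds_iff)
  have "Field \<phi> \<noteq> {}"
    using assms embeds_empty_Field[of "{(a, a)}" \<phi>] by (auto simp: equimorphic_def Field_def)
  then obtain b where b: "b \<in> Field \<phi>" by auto
  have eq: "x = b" if "x \<in> Field \<phi>" for x
  proof -
    have "f x = a" "f b = a"
      using order_embeddingD(1)[OF f that] order_embeddingD(1)[OF f b] by (auto simp: Field_def)
    then show ?thesis using order_embeddingD(3)[OF f that b] by simp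
  qed
  then have "\<phi> \<subseteq> {(b, b)}" by (auto dest: FieldI1 FieldI2)
  moreover have "\<phi> \<noteq> {}" using b by auto
  ultimately show ?thesis by blast
qed

lemma thick_shuffle:
  fixes \<rho> \<phi> :: "'u rel" and \<psi> :: "'u \<Rightarrow> 'u rel"
  assumes lin: "Linear_order \<rho>" and sq: "\<rho> \<equiv>\<^sub>o ordered_square \<rho>" and sh: "shuffle_sum \<rho> \<psi>"
    and \<psi>: "\<And>x. x \<in> Field \<rho> \<Longrightarrow> (\<exists>a. \<psi> x = {(a, a)}) \<or> thick (\<psi> x)"
    and \<phi>: "\<phi> \<equiv>\<^sub>o ordered_sum \<rho> \<psi>"
  shows "(\<exists>a. \<phi> = {(a, a)}) \<or> thick \<phi>"
\<comment> \<open>Two distinct points are what the disjoint intervals and the increasing sequence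
  start from; \<open>0\<close> and \<open>1\<close> as index are handled directly.\<close>
proof (cases "\<exists>a b. a \<in> Field \<rho> \<and> b \<in> Field \<rho> \<and> (a, b) \<in> \<rho> \<and> a \<noteq> b")
  case True
  then obtain a b where ab: "a \<in> Field \<rho>" "b \<in> Field \<rho>" "(a, b) \<in> \<rho>" "a \<noteq> b" by auto
  have sq': "ordered_square \<rho> \<lesssim>\<^sub>o \<rho>" using sq by (simp add: equimorphic_def)
  show ?thesis
    using thick_redistributable_sum[OF thick_square(1)[OF lin sq' ab] lin
        thick_square(2)[OF lin sq' ab] \<psi> redistributable_shuffle_sum[OF lin sq' ab sh] \<phi>]
    by blast
next
  case False
  then have uniq: "a = b" if "a \<in> Field \<rho>" "b \<in> Field \<rho>" for a b
    using lin that unfolding order_on_defs total_on_def by metis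
  show ?thesis
  proof (cases "Field \<rho> = {}")
    case True
    then have "Field (ordered_sum \<rho> \<psi>) = {}" by (simp add: Field_ordered_sum)
    then have "Field \<phi> = {}" using \<phi> embeds_empty_Field by (auto simp: equimorphic_def)
    then show ?thesis by (simp add: thick_empty)
  next
    case False
    then obtain a where a: "Field \<rho> = {a}" using uniq by blast
    have "\<phi> \<equiv>\<^sub>o \<psi> a" using equimorphic_trans[OF \<phi> ordered_sum_singleton_equimorphic[OF a]] .
    then show ?thesis
      using \<psi>[of a] a equimorphic_singleton thick_equimorphic by (metis singletonI)
  qed
qed

theorem theorem5p14:
  fixes \<F> :: "'u rel set"
  assumes "order_type_class \<F>"
    and "\<forall>\<rho>\<in>\<F>. \<rho> \<equiv>\<^sub>o ordered_square \<rho> \<or>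
                infinite_regular_cardinal \<rho> \<or> infinite_regular_cardinal (\<rho>\<inverse>)"
  shows "\<forall>\<phi> \<in> sum_closure \<F>.
           (\<exists>a. \<phi> = {(a, a)}) \<or>
           (\<exists>\<psi> :: 'u rel. Linear_order \<psi> \<and> \<phi> \<equiv>\<^sub>o \<psi> \<and> no_finite_F_classes \<psi>)"
  unfolding thick_def[symmetric]
proof
  have lin: "Linear_order \<rho>" if "\<rho> \<in> \<F>" for \<rho>
    using assms(1) that by (simp add: order_type_class_def)
  \<comment> \<open>An infinite index, as in both kinds of unbounded sums, forces the infinite
    universe required for copying sums back to \<open>'u\<close>.\<close>
  have inf: "infinite (UNIV :: 'u set)" if "infinite (Field \<rho>)" for \<rho> :: "'u rel"
    using that finite_subset[OF subset_UNIV] by blast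
  fix \<phi> assume "\<phi> \<in> sum_closure \<F>"
  then show "(\<exists>a. \<phi> = {(a, a)}) \<or> thick \<phi>"
  proof induction
    case zero
    show ?case by (simp add: thick_empty)
  next
    case (one a)
    show ?case by blast
  next
    case (shuffle \<rho> \<psi> \<phi> f)
    then show ?case using thick_shuffle[OF lin] iso_imp_equimorphic by blast
  next
    case (unbounded_sum \<rho> \<psi> \<phi> f)
    then have reg: "infinite_regular_cardinal \<rho>" by (simp add: regular_unbounded_sum_def)
    then have "infinite (Field \<rho>)" by (simp add: infinite_regular_cardinal_def)
    then show ?case
      using thick_redistributable_sum[OF inf lin thick_regular(1)[OF reg] _
          redistributable_unbounded_sum iso_imp_equimorphic] unbounded_sum by blast
  next
    case (unbounded_reverse_sum \<rho> \<psi> \<phi> f)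
    then have reg: "infinite_regular_cardinal (\<rho>\<inverse>)"
      by (simp add: regular_unbounded_reverse_sum_def)
    then have "infinite (Field \<rho>)" by (simp add: infinite_regular_cardinal_def)
    moreover have "regular_unbounded_sum (\<rho>\<inverse>) \<psi>"
      using unbounded_reverse_sum
      by (simp add: regular_unbounded_reverse_sum_def regular_unbounded_sum_def)
    then have "redistributable \<rho> \<psi>"
      using redistributable_unbounded_sum redistributable_converse by blast
    moreover have "thick \<rho>" using thick_regular(2)[OF reg] by simp
    ultimately show ?case
      using thick_redistributable_sum[OF inf lin _ _ _ iso_imp_equimorphic]
        unbounded_reverse_sum by blast
  qed
qed

end
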